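(* There exist positive constants $\bar\lambda$, $P\in\mathbb N$ and $\kappa_\infty$ (where $\kappa_\infty$ is independent of $K_n$ and $\lambda$) such that for any $\lambda\in[0,\bar\lambda]$ and any $K_n$ with $n/K_n\ge P$, $$\big\|\hat b(\bar y^1)-\hat b(\bar y^2)\big\|_\infty\le\kappa_\infty\big\|\bar y^1-\bar y^2\big\|_\infty,\qquad\forall\ \bar y^1,\bar y^2\in\mathbb R^{K_n+1},$$ where $\hat b:\mathbb R^{K_n+1}\to\mathbb R^{K_n+1}$ is the optimal spline coefficient map defined in the context.
   Context: Let $n,K_n$ be positive integers with $K_n\ge2$ and $n/K_n$ an integer. Let $x_i=i/n$, $i=1,\dots,n$. The linear B-spline basis with equally spaced knots $\kappa_k=k/K_n$ is $B^{[1]}_k(x)=\max\{0,\,1-|K_nx-(k-1)|\}$, $x\in[0,1]$, $k=1,\dots,K_n+1$. Let $X=[B^{[1]}_k(x_i)]_{i,k}\in\mathbb R^{n\times(K_n+1)}$, $\beta_n:=\sum_{i=1}^n(B^{[1]}_k(x_i))^2$ for $k\in\{2,\dots,K_n\}$ (independent of such $k$), and $\Gamma:=X^TX/\beta_n$. Let $D_2\in\mathbb R^{(K_n-1)\times(K_n+1)}$ be the second-order difference matrix, $(D_2b)_i=b_i-2b_{i+1}+b_{i+2}$, and $\Lambda:=\Gamma+\lambda D_2^TD_2$. Let $\Omega:=\{b\in\mathbb R^{K_n+1}:D_2b\ge0\}$ (componentwise). For $\bar y\in\mathbb R^{K_n+1}$, $$\hat b(\bar y):=\arg\min_{b\in\Omega}\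 \tfrac12b^T\Lambda b-b^T\bar y .$$ The map $\hat b$ depends on $n,K_n,\lambda$. $\|\cdot\|_\infty$ is the max norm on vectors. *)

theory Defs
  imports Complex_Main "Jordan_Normal_Form.Matrix"
begin

text \<open>The number of knots varies inside the theorem, so vectors and matrices are those of
  \<^theory>\<open>Jordan_Normal_Form.Matrix\<close>, with explicit dimensions. Their entries are numbered from 0,
  hence the shifts \<open>i + 1\<close> and \<open>k + 1\<close> below; the index \<open>k\<close> of \<open>bspline1\<close> and the design points
  \<open>i / n\<close> are numbered from 1.\<close>

definition bspline1 :: "nat \<Rightarrow> nat \<Rightarrow> real \<Rightarrow> real" where
  "bspline1 K k x = max 0 (1 - \<bar>real K * x - (real k - 1)\<bar>)"

definition design_mat :: "nat \<Rightarrow> nat \<Rightarrow> real mat" where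
  "design_mat n K = mat n (K + 1) (\<lambda>(i, k). bspline1 K (k + 1) (real (i + 1) / real n))"

definition col_sq_sum :: "nat \<Rightarrow> nat \<Rightarrow> nat \<Rightarrow> real" where
  "col_sq_sum n K k = (\<Sum>i = 1..n. (bspline1 K k (real i / real n))\<^sup>2)"

text \<open>The choice \<open>k = 2\<close> is immaterial among \<open>2, \<dots>, K\<close>, see \<open>beta_eq\<close> below.\<close>

definition beta :: "nat \<Rightarrow> nat \<Rightarrow> real" where
  "beta n K = col_sq_sum n K 2"

lemma beta_eq:
  assumes "n > 0" "K \<ge> 2" "K dvd n" "k \<in> {2..K}"
  shows "col_sq_sum n K k = beta n K"
proof -
  from assms obtain M where M: "n = K * M" by blast
  with assms have M0: "M > 0" by simp
  have val: "bspline1 K l (real i / real n) = max 0 (1 - \<bar>real i / real M - (real l - 1)\<bar>)" for l i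
    using assms M by (simp add: bspline1_def)
  have shift: "col_sq_sum n K l
      = (\<Sum>i = 1..2 * M. (max 0 (1 - \<bar>real i / real M - 1\<bar>))\<^sup>2)" if l: "l \<in> {2..K}" for l
  proof -
    define s where "s = (l - 2) * M"
    have le: "s + 2 * M \<le> n"
    proof -
      have "s + 2 * M = l * M" using l
        by (metis add_mult_distrib atLeastAtMost_iff le_add_diff_inverse2 s_def)
      thus ?thesis using l M by simp
    qed
    have rs: "real s = (real l - 2) * real M" using l by (simp add: s_def of_nat_diff)
    have "col_sq_sum n K l
        = (\<Sum>i = 1 + s..2 * M + s. (max 0 (1 - \<bar>real i / real M - (real l - 1)\<bar>))\<^sup>2)"
      unfolding col_sq_sum_def val
    proof (rule sum.mono_neutral_right)
      show "\<forall>i\<in>{1..n} - {1 + s..2 * M + s}.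
          (max 0 (1 - \<bar>real i / real M - (real l - 1)\<bar>))\<^sup>2 = 0"
      proof
        fix i assume "i \<in> {1..n} - {1 + s..2 * M + s}"
        hence "i \<le> s \<or> i \<ge> 2 * M + s" by auto
        hence "real i \<le> real s \<or> real i \<ge> 2 * real M + real s"
          by (metis of_nat_add of_nat_le_iff of_nat_mult of_nat_numeral)
        hence "real i \<le> (real l - 2) * real M \<or> real i \<ge> real l * real M"
          by (simp add: rs algebra_simps)
        hence "real i / real M \<le> real l - 2 \<or> real i / real M \<ge> real l"
          using M0 by (simp add: divide_simps)
        hence "1 - \<bar>real i / real M - (real l - 1)\<bar> \<le> 0" by linarith
        thus "(max 0 (1 - \<bar>real i / real M - (real l - 1)\<bar>))\<^sup>2 = 0" by simp
      qed
    qed (use le in auto)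
    also have "\<dots> = (\<Sum>i = 1..2 * M. (max 0 (1 - \<bar>real (i + s) / real M - (real l - 1)\<bar>))\<^sup>2)"
      by (rule sum.shift_bounds_cl_nat_ivl)
    also have "\<dots> = (\<Sum>i = 1..2 * M. (max 0 (1 - \<bar>real i / real M - 1\<bar>))\<^sup>2)"
    proof (rule sum.cong[OF refl])
      fix i
      have "real (i + s) / real M - (real l - 1) = real i / real M - 1"
        using M0 by (simp add: rs field_simps)
      thus "(max 0 (1 - \<bar>real (i + s) / real M - (real l - 1)\<bar>))\<^sup>2
          = (max 0 (1 - \<bar>real i / real M - 1\<bar>))\<^sup>2" by simp
    qed
    finally show ?thesis .
  qed
  show ?thesis using shift[of k] shift[of 2] assms by (simp add: beta_def)
qed

definition Gamma_mat :: "nat \<Rightarrow> nat \<Rightarrow> real mat" where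
  "Gamma_mat n K = (1 / beta n K) \<cdot>\<^sub>m (transpose_mat (design_mat n K) * design_mat n K)"

definition diff2_mat :: "nat \<Rightarrow> real mat" where
  "diff2_mat K = mat (K - 1) (K + 1)
     (\<lambda>(i, j). if j = i then 1 else if j = i + 1 then - 2 else if j = i + 2 then 1 else 0)"

definition Lambda_mat :: "nat \<Rightarrow> nat \<Rightarrow> real \<Rightarrow> real mat" where
  "Lambda_mat n K lam = Gamma_mat n K + lam \<cdot>\<^sub>m (transpose_mat (diff2_mat K) * diff2_mat K)"

text \<open>The order on vectors is componentwise.\<close>

definition Omega :: "nat \<Rightarrow> real vec set" where
  "Omega K = {b \<in> carrier_vec (K + 1). diff2_mat K *\<^sub>v b \<ge> 0\<^sub>v (K - 1)}"

text \<open>For \<open>n / K = 1\<close> and \<open>lam = 0\<close> the objective is not strictly convex and may have no (or no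
  unique) minimiser on \<open>Omega K\<close>; then \<open>arg_min_on\<close> yields an unspecified value.\<close>

definition bhat :: "nat \<Rightarrow> nat \<Rightarrow> real \<Rightarrow> real vec \<Rightarrow> real vec" where
  "bhat n K lam y =
     arg_min_on (\<lambda>b. 1 / 2 * (b \<bullet> (Lambda_mat n K lam *\<^sub>v b)) - b \<bullet> y) (Omega K)"

text \<open>Only meaningful for vectors of positive dimension.\<close>

definition max_norm :: "real vec \<Rightarrow> real" where
  "max_norm v = Max ((\<lambda>i. \<bar>v $ i\<bar>) ` {..<dim_vec v})"

end

theory Submission
  imports Defs "HOL-Analysis.Lipschitz"
begin

text \<open>
  At a minimiser \<open>b\<close> let \<open>T\<close> consist of \<open>0\<close>, \<open>K\<close> and the knots at which \<open>b\<close> has a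
  strict kink. Moving in both directions inside the space of vectors that are affine between
  consecutive elements of \<open>T\<close> shows that the gradient at \<open>b\<close> annihilates this space. Along a
  segment of data vectors, the parameters whose minimiser belongs to a given \<open>T\<close> form a closed
  set; finitely many of these sets cover the segment, so it suffices to have one Lipschitz constant
  for all \<open>T\<close>. For two data vectors in the same set, the difference \<open>w\<close> of the minimisers lies in
  the space and satisfies \<open>\<langle>\<Lambda> w, v\<rangle> = \<langle>z, v\<rangle>\<close> for all \<open>v\<close> in it, where \<open>z\<close> is the
  difference of the data.
  Now \<open>\<bar>w\<bar>\<close> is maximal at some \<open>p \<in> T\<close>. Test with the hat function supported between the neighbours
  \<open>q < p < r\<close> of \<open>p\<close> in \<open>T\<close>: the Gram part is at least a constant times \<open>(r - q) \<bar>w p\<bar>\<close>, because a hat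
  function dominates its neighbours in the sampled Gram matrix as soon as every knot interval
  contains three design points, while both the penalty (for small \<open>\<lambda>\<close>) and the right-hand side
  are controlled by the sum of the entries of the hat function, which is at most \<open>2 (r - q)\<close>.
\<close>

section \<open>Second differences, sums over sampled ramps, hat functions\<close>

definition d2 :: "(nat \<Rightarrow> real) \<Rightarrow> nat \<Rightarrow> real" where
  "d2 u i = u i - 2 * u (i + 1) + u (i + 2)"

lemma d2_add_scaled: "d2 (\<lambda>k. u k + t * v k) i = d2 u i + t * d2 v i"
  by (simp add: d2_def algebra_simps)

text \<open>\<open>d2 u i\<close> is centred at \<open>i + 1\<close>, so the hypothesis forbids
  kinks exactly at the interior indices \<open>q + 1, ..., p - 1\<close>. The recurrence then
  repeats the first increment.\<close>

lemma affine_of_d2_zero: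
  fixes u :: "nat \<Rightarrow> real"
  assumes "q < p" and zero: "\<And>i. q \<le> i \<Longrightarrow> i + 1 < p \<Longrightarrow> d2 u i = 0"
    and "q \<le> k" "k \<le> p"
  shows "u k = u q + (real k - real q) / (real p - real q) * (u p - u q)"
proof -
  have aff: "u (q + m) = u q + real m * (u (q + 1) - u q)" if "q + m \<le> p" for m
    using that
  proof (induction m rule: induct_nat_012)
    case (ge2 m)
    have "d2 u (q + m) = 0" using zero ge2.prems by simp
    then have "u (q + Suc (Suc m)) = 2 * u (q + Suc m) - u (q + m)"
      by (simp add: d2_def)
    then show ?case using ge2 by (simp add: algebra_simps)
  qed auto
  define s where "s = u (q + 1) - u q"
  have "u p = u q + (real p - real q) * s" "u k = u q + (real k - real q) * s"
    using aff[of "p - q"] aff[of "k - q"] assms by (simp_all add: of_nat_diff s_def)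
  moreover from this(1) have "u p - u q = (real p - real q) * s" by simp
  ultimately show ?thesis using \<open>q < p\<close> by simp
qed

lemma sum_upto_real: "(\<Sum>l = 1..N. real l) = real N * (real N + 1) / 2"
  by (induction N) (auto simp: field_simps)

lemma sum_squares_upto_real:
  "(\<Sum>l = 1..N. (real l)\<^sup>2) = real N * (real N + 1) * (2 * real N + 1) / 6"
  by (induction N) (auto simp: field_simps power2_eq_square)

text \<open>The function \<open>2 s^2 - s\<close> comes from \<open>ramp_product\<close> and has
  integral \<open>1 / 6\<close> over \<open>[0, 1]\<close>. Sampled at \<open>s = l / N\<close>,
  with the peak \<open>s = 1\<close> included, it sums to
  \<open>(N + 1) (N + 2) / (6 N)\<close>.\<close>

lemma ramp_up_sum:
  assumes "N \<ge> 3"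
  shows "(\<Sum>l = 1..N. 2 * (real l / real N)\<^sup>2 - real l / real N) \<ge> real N / 27"
proof -
  have N: "real N \<ge> 3" using assms by simp
  have "(\<Sum>l = 1..N. 2 * (real l / real N)\<^sup>2 - real l / real N)
      = 2 / (real N)\<^sup>2 * (\<Sum>l = 1..N. (real l)\<^sup>2) - 1 / real N * (\<Sum>l = 1..N. real l)"
    by (simp add: sum_subtractf sum_distrib_left power_divide)
  also have "\<dots> = (real N + 1) * (real N + 2) / (6 * real N)"
    unfolding sum_upto_real sum_squares_upto_real using N
    by (simp add: field_simps power2_eq_square)
  also have "\<dots> \<ge> real N / 27"
    using N by (simp add: field_simps)
  finally show ?thesis .
qed

text \<open>Here \<open>s = 0\<close> is sampled instead of the peak \<open>s = 1\<close>, so the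
  sum drops to \<open>(N - 1) (N - 2) / (6 N)\<close>. It vanishes for \<open>N = 2\<close>; this is
  the source of the three design points per knot interval.\<close>

lemma ramp_down_sum:
  assumes "N \<ge> 3"
  shows "(\<Sum>l = 1..N. 2 * (1 - real l / real N)\<^sup>2 - (1 - real l / real N)) \<ge> real N / 27"
proof -
  have N: "real N \<ge> 3" using assms by simp
  have "(\<Sum>l = 1..N. 2 * (1 - real l / real N)\<^sup>2 - (1 - real l / real N))
      = (\<Sum>l = 1..N. 1 - 3 / real N * real l + 2 / (real N)\<^sup>2 * (real l)\<^sup>2)"
    using N by (intro sum.cong) (auto simp: field_simps power2_eq_square)
  also have "\<dots> = real N - 3 / real N * (\<Sum>l = 1..N. real l)
      + 2 / (real N)\<^sup>2 * (\<Sum>l = 1..N. (real l)\<^sup>2)"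
    by (simp add: sum_subtractf sum.distrib sum_distrib_left)
  also have "\<dots> = (real N - 1) * (real N - 2) / (6 * real N)"
    unfolding sum_upto_real sum_squares_upto_real using N
    by (simp add: field_simps power2_eq_square)
  also have "\<dots> \<ge> real N / 27"
  proof -
    \<comment> \<open>The claim with denominators cleared; equality at \<open>N = 3\<close> fixes
      the constant 27.\<close>
    have "0 \<le> (7 * real N - 6) * (real N - 3)" using N by simp
    then show ?thesis using N by (simp add: field_simps)
  qed
  finally show ?thesis .
qed

text \<open>The choices \<open>q = p\<close> and \<open>r = p\<close> are allowed and give the half hats at the two end knots.\<close>

definition hat :: "nat \<Rightarrow> nat \<Rightarrow> nat \<Rightarrow> nat \<Rightarrow> real" where
  "hat q p r k = (if k = p then 1
     else if q < k \<and> k < p then (real k - real q) / (real p - real q)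
     else if p < k \<and> k < r then (real r - real k) / (real r - real p) else 0)"

lemma hat_bounds: "0 \<le> hat q p r k" "hat q p r k \<le> 1"
  by (auto simp: hat_def)

lemma hat_outside: "k < q \<or> r < k \<Longrightarrow> q \<le> p \<Longrightarrow> p \<le> r \<Longrightarrow> hat q p r k = 0"
  by (auto simp: hat_def)

lemma hat_left: "q < p \<Longrightarrow> q \<le> k \<Longrightarrow> k \<le> p \<Longrightarrow> hat q p r k = (real k - real q) / (real p - real q)"
  by (auto simp: hat_def)

lemma hat_right: "p < r \<Longrightarrow> p \<le> k \<Longrightarrow> k \<le> r \<Longrightarrow> hat q p r k = (real r - real k) / (real r - real p)"
  by (auto simp: hat_def)

lemma sum_split_ivl:
  fixes f :: "nat \<Rightarrow> real"
  assumes "a \<le> b" "b \<le> c"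
  shows "sum f {a + 1..c} = sum f {a + 1..b} + sum f {b + 1..c}"
proof -
  have "{a + 1..c} = {a + 1..b} \<union> {b + 1..c}" using assms by auto
  then show ?thesis by (simp add: sum.union_disjoint)
qed

text \<open>\<open>W\<close> is the value under the peak, \<open>x\<close> the value at the foot of
  the ramp and \<open>s\<close> the hat. In the worst case \<open>x = - W\<close> both sides
  agree.\<close>

lemma ramp_product:
  fixes W x s :: real
  assumes "\<bar>x\<bar> \<le> W" "0 \<le> s" "s \<le> 1"
  shows "W * (2 * s\<^sup>2 - s) \<le> (W * s + x * (1 - s)) * s"
proof -
  have "0 \<le> (W + x) * ((1 - s) * s)" using assms by (intro mult_nonneg_nonneg) auto
  then show ?thesis by (simp add: algebra_simps power2_eq_square)
qed

lemma cancel_slope: "d \<noteq> 0 \<Longrightarrow> (d * t) * (e / d) = t * (e :: real)"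
  by simp

lemma young:
  fixes a x z r :: real
  assumes "0 < a" "z\<^sup>2 / a \<le> r"
  shows "x * z \<le> a * x\<^sup>2 / 2 + r / 2"
proof -
  have "0 \<le> (a * x - z)\<^sup>2 / a" using assms by simp
  also have "\<dots> = a * x\<^sup>2 - 2 * (x * z) + z\<^sup>2 / a"
    using assms by (simp add: field_simps power2_eq_square)
  finally show ?thesis using assms(2) by linarith
qed

section \<open>Matrix-vector identities\<close>

lemma scalar_prod_transpose_mult:
  fixes A :: "real mat"
  assumes A: "A \<in> carrier_mat r m" and b: "b \<in> carrier_vec m" and c: "c \<in> carrier_vec m"
  shows "scalar_prod b ((transpose_mat A * A) *\<^sub>v c)
    = (\<Sum>i<r. vec_index (A *\<^sub>v b) i * vec_index (A *\<^sub>v c) i)"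
proof -
  have "scalar_prod b ((transpose_mat A * A) *\<^sub>v c) = scalar_prod (transpose_mat A *\<^sub>v (A *\<^sub>v c)) b"
    using A b c by (subst assoc_mult_mat_vec[of _ m r _ m]) (auto intro!: comm_scalar_prod)
  also have "\<dots> = scalar_prod (A *\<^sub>v c) (A *\<^sub>v b)"
    using A b c by (intro transpose_vec_mult_scalar[of A r m]) auto
  also have "\<dots> = (\<Sum>i<r. vec_index (A *\<^sub>v b) i * vec_index (A *\<^sub>v c) i)"
    using A by (simp add: scalar_prod_def lessThan_atLeast0 mult.commute)
  finally show ?thesis .
qed

lemma smult_mat_mult_vec:
  fixes A :: "real mat"
  shows "A \<in> carrier_mat r m \<Longrightarrow> v \<in> carrier_vec m \<Longrightarrow> (a \<cdot>\<^sub>m A) *\<^sub>v v = a \<cdot>\<^sub>v (A *\<^sub>v v)"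
  by (intro eq_vecI) (auto simp: scalar_prod_def sum_distrib_left mult.assoc)

section \<open>The quadratic form and the piecewise affine spaces\<close>

locale spline_qp =
  fixes n K M :: nat and lam :: real
  assumes n_eq: "n = K * M" and M: "3 \<le> M" and K: "2 \<le> K" and lam: "0 \<le> lam"
begin

text \<open>Vectors are functions on \<open>nat\<close> here; only their values at \<open>0, \<dots>, K\<close> matter.\<close>

definition S :: "(nat \<Rightarrow> real) \<Rightarrow> nat \<Rightarrow> real" where
  "S u i = (\<Sum>k\<le>K. bspline1 K (k + 1) (real i / real n) * u k)"

text \<open>The bilinear form of \<open>Lambda_mat n K lam\<close>, as \<open>scalar_Lambda\<close>
  confirms.\<close>

definition form :: "(nat \<Rightarrow> real) \<Rightarrow> (nat \<Rightarrow> real) \<Rightarrow> real" where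
  "form u v = (\<Sum>i = 1..n. S u i * S v i) / beta n K + lam * (\<Sum>i<K - 1. d2 u i * d2 v i)"

definition pairing :: "(nat \<Rightarrow> real) \<Rightarrow> (nat \<Rightarrow> real) \<Rightarrow> real" where
  "pairing y u = (\<Sum>k\<le>K. y k * u k)"

text \<open>Kinks are allowed only at indices in \<open>T\<close>; the shift reflects that
  \<open>d2 u i\<close> is centred at \<open>i + 1\<close>.\<close>

definition knot_space :: "nat set \<Rightarrow> (nat \<Rightarrow> real) set" where
  "knot_space T = {u. \<forall>i<K - 1. i + 1 \<notin> T \<longrightarrow> d2 u i = 0}"

lemma bspline_val: "bspline1 K (k + 1) (real i / real n) = max 0 (1 - \<bar>real i / real M - real k\<bar>)"
  using M K by (simp add: bspline1_def n_eq)

lemma S_add_scaled: "S (\<lambda>k. u k + t * v k) i = S u i + t * S v i"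
  by (simp add: S_def sum.distrib sum_distrib_left algebra_simps)

lemma form_sym: "form u v = form v u"
  by (simp add: form_def mult.commute)

lemma form_add_scaled_left: "form (\<lambda>k. u k + t * v k) w = form u w + t * form v w"
  by (simp add: form_def S_add_scaled d2_add_scaled sum.distrib sum_distrib_left distrib_right
      add_divide_distrib algebra_simps)

lemma form_add_scaled_right: "form w (\<lambda>k. u k + t * v k) = form w u + t * form w v"
  using form_add_scaled_left form_sym by metis

lemma pairing_add_scaled_left: "pairing (\<lambda>k. y k + t * z k) u = pairing y u + t * pairing z u"
  by (simp add: pairing_def sum.distrib sum_distrib_left algebra_simps)

lemma pairing_add_scaled_right: "pairing y (\<lambda>k. u k + t * v k) = pairing y u + t * pairing y v"
  by (simp add: pairing_def sum.distrib sum_distrib_left algebra_simps)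

section \<open>Sampled splines as piecewise linear interpolants\<close>

lemma S_interp:
  assumes "j < K" "j * M \<le> i" "i \<le> (j + 1) * M"
  shows "S u i = (1 - (real i / real M - real j)) * u j + (real i / real M - real j) * u (j + 1)"
proof -
  have "real (j * M) \<le> real i" "real i \<le> real ((j + 1) * M)"
    using assms(2,3) by (simp_all only: of_nat_le_iff)
  then have x: "real j \<le> real i / real M" "real i / real M \<le> real j + 1"
    using M by (simp_all add: field_simps)
  have "S u i = (\<Sum>k\<in>{j, j + 1}. bspline1 K (k + 1) (real i / real n) * u k)"
    unfolding S_def
  proof (rule sum.mono_neutral_right)
    show "\<forall>k\<in>{..K} - {j, j + 1}. bspline1 K (k + 1) (real i / real n) * u k = 0"
    proof
      fix k assume "k \<in> {..K} - {j, j + 1}"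
      then have "k + 1 \<le> j \<or> j + 2 \<le> k" by auto
      then have "real k + 1 \<le> real j \<or> real j + 2 \<le> real k" by linarith
      with x have "1 - \<bar>real i / real M - real k\<bar> \<le> 0" by linarith
      then show "bspline1 K (k + 1) (real i / real n) * u k = 0"
        unfolding bspline_val by simp
    qed
  qed (use assms in auto)
  also have "\<dots> = (1 - (real i / real M - real j)) * u j + (real i / real M - real j) * u (j + 1)"
    using x by (simp add: bspline_val del: One_nat_def)
  finally show ?thesis .
qed

text \<open>Linear interpolation reproduces affine data, so it is enough to find one knot interval
  containing the design point; knot \<open>k\<close> sits at design point
  \<open>k * M\<close>.\<close>

lemma S_affine:
  assumes "a < b" "b \<le> K" "a * M \<le> i" "i \<le> b * M"
    and aff: "\<And>k. a \<le> k \<Longrightarrow> k \<le> b \<Longrightarrow> u k = c + (real k - real a) * s"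
  shows "S u i = c + (real i / real M - real a) * s"
proof -
  obtain j where j: "a \<le> j" "j < b" "j * M \<le> i" "i \<le> (j + 1) * M"
  \<comment> \<open>At the right end \<open>i div M\<close> would be \<open>b\<close>, one interval
    too far.\<close>
  proof (cases "i = b * M")
    case True
    show ?thesis by (rule that[of "b - 1"]) (use assms True in auto)
  next
    case False
    then have "i < b * M" using assms by simp
    then have "i div M < b" using M by (simp add: less_mult_imp_div_less)
    moreover have "a \<le> i div M" using assms M by (simp add: less_eq_div_iff_mult_less_eq)
    moreover have "i \<le> (i div M + 1) * M"
      using dividend_less_div_times[of M i] M by (simp add: algebra_simps)
    ultimately show ?thesis using that[of "i div M"] by simp
  qed
  have "j < K" using j assms by simp
  have u: "u j = c + (real j - real a) * s" "u (j + 1) = c + (real j + 1 - real a) * s"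
    using aff[of j] aff[of "j + 1"] j by simp_all
  show ?thesis
    unfolding S_interp[OF \<open>j < K\<close> j(3,4)] u by (simp add: algebra_simps)
qed

lemma S_node: "k \<le> K \<Longrightarrow> S u (k * M) = u k"
proof (cases "k < K")
  case True
  then show ?thesis using S_interp[of k "k * M" u] M by simp
next
  case False
  assume "k \<le> K"
  with False K have k: "k - 1 < K" "Suc (k - 1) = k" by auto
  have "real (k * M) / real M - real (k - 1) = 1"
    using M k by (simp add: of_nat_diff)
  then show ?thesis using S_interp[of "k - 1" "k * M" u] k M by simp
qed

text \<open>The peak sample at \<open>i = M\<close> contributes 1. Only the first
  \<open>2 * M\<close> samples can be nonzero, each with square at most 1.\<close>

lemma beta_bounds: "1 \<le> beta n K" "beta n K \<le> 2 * real M"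
proof -
  have b: "beta n K = (\<Sum>i = 1..n. (max 0 (1 - \<bar>real i / real M - 1\<bar>))\<^sup>2)"
    using bspline_val[of 1] by (simp add: beta_def col_sq_sum_def numeral_2_eq_2)
  have Mn: "2 * M \<le> n" using K by (simp add: n_eq)
  have "(\<Sum>i\<in>{M}. (max 0 (1 - \<bar>real i / real M - 1\<bar>))\<^sup>2) \<le> beta n K"
    unfolding b by (rule sum_mono2) (use M Mn in auto)
  then show "1 \<le> beta n K" using M by simp
  have "beta n K = (\<Sum>i = 1..2 * M. (max 0 (1 - \<bar>real i / real M - 1\<bar>))\<^sup>2)"
    unfolding b
  proof (rule sum.mono_neutral_right)
    show "\<forall>i\<in>{1..n} - {1..2 * M}. (max 0 (1 - \<bar>real i / real M - 1\<bar>))\<^sup>2 = 0"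
    proof
      fix i assume "i \<in> {1..n} - {1..2 * M}"
      then have "real (2 * M) \<le> real i" by auto
      then have "2 \<le> real i / real M" using M by (simp add: field_simps)
      then show "(max 0 (1 - \<bar>real i / real M - 1\<bar>))\<^sup>2 = 0" by simp
    qed
  qed (use Mn in auto)
  also have "\<dots> \<le> (\<Sum>i = 1..2 * M. 1)"
    by (rule sum_mono) (auto simp: power_le_one_iff)
  finally show "beta n K \<le> 2 * real M" by simp
qed

section \<open>Testing the form with hat functions\<close>

lemma sum_hat:
  assumes "q \<le> p" "p \<le> r" "q < r" "r \<le> K"
  shows "(\<Sum>k\<le>K. hat q p r k) \<le> 2 * (real r - real q)"
proof -
  have "(\<Sum>k\<le>K. hat q p r k) = (\<Sum>k = q..r. hat q p r k)"
    using assms by (intro sum.mono_neutral_right) (auto simp: hat_outside not_le)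
  also have "\<dots> \<le> (\<Sum>k = q..r. 1)"
    by (rule sum_mono) (rule hat_bounds)
  also have "\<dots> = real r - real q + 1" using assms by (simp add: of_nat_diff)
  also have "\<dots> \<le> 2 * (real r - real q)"
  proof -
    have "q + 1 \<le> r" using assms by simp
    then have "real (q + 1) \<le> real r" by (simp only: of_nat_le_iff)
    then show ?thesis by simp
  qed
  finally show ?thesis .
qed

text \<open>The hat bends only at \<open>q\<close>, \<open>p\<close> and \<open>r\<close>. A side
  may degenerate only at an end of the knot range, where no second difference sees the jump.\<close>

lemma hat_in_knot_space:
  assumes "q \<le> p" "p \<le> r" "r \<le> K" "q < p \<or> p = 0" "p < r \<or> p = K" "p \<in> T"
    and "q < p \<Longrightarrow> q \<in> T" "p < r \<Longrightarrow> r \<in> T"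
  shows "hat q p r \<in> knot_space T"
  unfolding knot_space_def
proof (clarify)
  fix i assume i: "i < K - 1" "i + 1 \<notin> T"
  have ne: "i + 1 \<noteq> p" using i assms by metis
  have ne1: "q < p \<Longrightarrow> i + 1 \<noteq> q" and ne2: "p < r \<Longrightarrow> i + 1 \<noteq> r" using i assms by metis+
  have "i + 1 < q \<or> q = i + 1 \<or> (q \<le> i \<and> i + 1 < p) \<or> (p \<le> i \<and> i + 1 < r) \<or> (p \<le> i \<and> r \<le> i)
     \<or> (p \<le> i \<and> i + 1 = r)"
    using ne assms(1) by linarith
  then consider "i + 1 < q" | "q < p" "q \<le> i" "i + 1 < p" | "p < r" "p \<le> i" "i + 1 < r" | "r \<le> i"
    using ne ne1 ne2 assms i by (smt (verit, best) le_neq_implies_less linorder_not_less le_trans)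
  then show "d2 (hat q p r) i = 0"
  proof cases
    case 1
    then have "i + 2 \<le> q" by simp
    then have "i + 2 < q \<or> (i + 2 = q \<and> q < p)" using assms 1 by linarith
    then have "hat q p r (i + 2) = 0"
      using assms hat_left[of q p "i+2" r] hat_outside[of "i+2" q r p] by auto
    then show ?thesis using 1 assms by (simp add: d2_def hat_outside)
  next
    case 2
    then show ?thesis by (simp add: d2_def hat_left add_divide_distrib[symmetric] diff_divide_distrib[symmetric])
  next
    case 3
    then show ?thesis by (simp add: d2_def hat_right add_divide_distrib[symmetric] diff_divide_distrib[symmetric])
  next
    case 4
    have "p < r" using 4 assms i by linarith
    then have "hat q p r i = 0"
      using 4 assms hat_right[of p r i q] hat_outside[of i q r p] by (cases "i = r") auto
    then show ?thesis using 4 assms by (simp add: d2_def hat_outside)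
  qed
qed

text \<open>With \<open>s = l / N\<close>, at the \<open>l\<close>-th design point after knot
  \<open>q\<close> the hat has the value \<open>s\<close> and \<open>w\<close> the value
  \<open>w p * s + w q * (1 - s)\<close>. Now \<open>ramp_product\<close> applies pointwise and
  \<open>ramp_up_sum\<close> to the total.\<close>

lemma left_ramp_sum:
  assumes "q < p" "p \<le> K" and zero: "\<And>i. q \<le> i \<Longrightarrow> i + 1 < p \<Longrightarrow> d2 w i = 0"
    and max: "\<bar>w q\<bar> \<le> w p"
  shows "w p * ((real p - real q) * real M / 27)
    \<le> (\<Sum>i = q * M + 1..p * M. S w i * S (hat q p r) i)"
proof -
  define N where "N = (p - q) * M"
  have "1 * 3 \<le> (p - q) * M" using assms M by (intro mult_le_mono) auto
  then have N: "3 \<le> N" by (simp add: N_def)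
  have rN: "real N = (real p - real q) * real M" using assms by (simp add: N_def of_nat_diff)
  have pM: "p * M = N + q * M" using assms by (simp add: N_def add_mult_distrib[symmetric])
  have "w p * ((real p - real q) * real M / 27) = w p * (real N / 27)" by (simp add: rN)
  also have "\<dots> \<le> w p * (\<Sum>l = 1..N. 2 * (real l / real N)\<^sup>2 - real l / real N)"
    by (rule mult_left_mono[OF ramp_up_sum[OF N]]) (use max in linarith)
  also have "\<dots> = (\<Sum>l = 1..N. w p * (2 * (real l / real N)\<^sup>2 - real l / real N))"
    by (simp add: sum_distrib_left)
  also have "\<dots> \<le> (\<Sum>l = 1..N. S w (l + q * M) * S (hat q p r) (l + q * M))"
  proof (rule sum_mono)
    fix l assume l: "l \<in> {1..N}"
    have d: "real p - real q \<noteq> 0" using assms(1) by simp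
    have bnd: "q * M \<le> l + q * M" "l + q * M \<le> p * M" using l pM by auto
    have x: "real (l + q * M) / real M - real q = (real p - real q) * (real l / real N)"
      using M assms(1) by (simp add: rN field_simps)
    have "S (hat q p r) (l + q * M)
        = 0 + (real (l + q * M) / real M - real q) * (1 / (real p - real q))"
      using assms(1,2) bnd by (rule S_affine) (use assms in \<open>simp add: hat_left\<close>)
    moreover have "S w (l + q * M)
        = w q + (real (l + q * M) / real M - real q) * ((w p - w q) / (real p - real q))"
      using assms(1,2) bnd
    proof (rule S_affine)
      fix k assume "q \<le> k" "k \<le> p"
      from affine_of_d2_zero[OF assms(1) zero this]
      show "w k = w q + (real k - real q) * ((w p - w q) / (real p - real q))" by simp
    qed
    ultimately have "S (hat q p r) (l + q * M) = real l / real N"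
      "S w (l + q * M) = w p * (real l / real N) + w q * (1 - real l / real N)"
      unfolding x cancel_slope[OF d] by (simp_all add: algebra_simps diff_divide_distrib)
    then show "w p * (2 * (real l / real N)\<^sup>2 - real l / real N)
        \<le> S w (l + q * M) * S (hat q p r) (l + q * M)"
      using ramp_product[OF max, of "real l / real N"] l by simp
  qed
  also have "\<dots> = (\<Sum>i = 1 + q * M..N + q * M. S w i * S (hat q p r) i)"
    by (rule sum.shift_bounds_cl_nat_ivl[symmetric])
  finally show ?thesis by (simp add: pM)
qed

text \<open>The mirror image with \<open>s = 1 - l / N\<close>. The sample under the peak is
  excluded, so the weaker \<open>ramp_down_sum\<close> is the relevant one.\<close>

lemma right_ramp_sum:
  assumes "p < r" "r \<le> K" and zero: "\<And>i. p \<le> i \<Longrightarrow> i + 1 < r \<Longrightarrow> d2 w i = 0"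
    and max: "\<bar>w r\<bar> \<le> w p"
  shows "w p * ((real r - real p) * real M / 27)
    \<le> (\<Sum>i = p * M + 1..r * M. S w i * S (hat q p r) i)"
proof -
  define N where "N = (r - p) * M"
  have "1 * 3 \<le> (r - p) * M" using assms M by (intro mult_le_mono) auto
  then have N: "3 \<le> N" by (simp add: N_def)
  have rN: "real N = (real r - real p) * real M" using assms by (simp add: N_def of_nat_diff)
  have rM: "r * M = N + p * M" using assms by (simp add: N_def add_mult_distrib[symmetric])
  have "w p * ((real r - real p) * real M / 27) = w p * (real N / 27)" by (simp add: rN)
  also have "\<dots> \<le> w p * (\<Sum>l = 1..N. 2 * (1 - real l / real N)\<^sup>2 - (1 - real l / real N))"
    by (rule mult_left_mono[OF ramp_down_sum[OF N]]) (use max in linarith)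
  also have "\<dots> = (\<Sum>l = 1..N. w p * (2 * (1 - real l / real N)\<^sup>2 - (1 - real l / real N)))"
    by (simp add: sum_distrib_left)
  also have "\<dots> \<le> (\<Sum>l = 1..N. S w (l + p * M) * S (hat q p r) (l + p * M))"
  proof (rule sum_mono)
    fix l assume l: "l \<in> {1..N}"
    have d: "real r - real p \<noteq> 0" using assms(1) by simp
    have bnd: "p * M \<le> l + p * M" "l + p * M \<le> r * M" using l rM by auto
    have x: "real (l + p * M) / real M - real p = (real r - real p) * (real l / real N)"
      using M assms(1) by (simp add: rN field_simps)
    have "S (hat q p r) (l + p * M)
        = 1 + (real (l + p * M) / real M - real p) * (- 1 / (real r - real p))"
      using assms(1,2) bnd by (rule S_affine) (use assms(1) in \<open>simp add: hat_right diff_divide_eq_iff\<close>)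
    moreover have "S w (l + p * M)
        = w p + (real (l + p * M) / real M - real p) * ((w r - w p) / (real r - real p))"
      using assms(1,2) bnd
    proof (rule S_affine)
      fix k assume "p \<le> k" "k \<le> r"
      from affine_of_d2_zero[OF assms(1) zero this]
      show "w k = w p + (real k - real p) * ((w r - w p) / (real r - real p))" by simp
    qed
    ultimately have "S (hat q p r) (l + p * M) = 1 - real l / real N"
      "S w (l + p * M) = w p * (1 - real l / real N) + w r * (1 - (1 - real l / real N))"
      unfolding x cancel_slope[OF d] by (simp_all add: algebra_simps diff_divide_distrib)
    then show "w p * (2 * (1 - real l / real N)\<^sup>2 - (1 - real l / real N))
        \<le> S w (l + p * M) * S (hat q p r) (l + p * M)"
      using ramp_product[OF max, of "1 - real l / real N"] l by simp
  qed
  also have "\<dots> = (\<Sum>i = 1 + p * M..N + p * M. S w i * S (hat q p r) i)"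
    by (rule sum.shift_bounds_cl_nat_ivl[symmetric])
  finally show ?thesis by (simp add: rM)
qed

text \<open>The case of a half hat causes no trouble: \<open>1 <= i <= q * M\<close> forces
  \<open>0 < q\<close> and hence \<open>q < p\<close>, while \<open>r * M < i <= n\<close> forces
  \<open>r < K\<close> and hence \<open>p < r\<close>.\<close>

lemma S_hat_zero:
  assumes "q \<le> p" "p \<le> r" "r \<le> K" "q < p \<or> p = 0" "p < r \<or> p = K"
    and "1 \<le> i" "i \<le> n" "i \<le> q * M \<or> r * M < i"
  shows "S (hat q p r) i = 0"
  using assms(8)
proof
  assume i: "i \<le> q * M"
  then have q: "0 < q" using assms(6) by (cases "q = 0") auto
  then have "q < p" using assms by auto
  have "S (hat q p r) i = 0 + (real i / real M - real 0) * 0"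
    using q by (rule S_affine) (use assms i \<open>q < p\<close> in \<open>auto simp: hat_def\<close>)
  then show ?thesis by simp
next
  assume i: "r * M < i"
  then have r: "r < K" using assms(3,7) by (cases "r = K") (auto simp: n_eq)
  then have "p < r" using assms by auto
  have "S (hat q p r) i = 0 + (real i / real M - real r) * 0"
    using r by (rule S_affine) (use assms i \<open>p < r\<close> in \<open>auto simp: hat_def n_eq\<close>)
  then show ?thesis by simp
qed

text \<open>16 is 4, from \<open>\<bar>d2 w i\<bar> \<le> 4 * W\<close>, times 4, the sum of the
  weights 1, 2, 1 in the bound for \<open>d2 v i\<close>. Measuring \<open>v\<close> by the sum of
  its entries makes the bound scale like the Gram part.\<close>

lemma penalty_bound:
  assumes w: "\<And>k. k \<le> K \<Longrightarrow> \<bar>w k\<bar> \<le> W" and v: "\<And>k. 0 \<le> v k"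
  shows "\<bar>\<Sum>i<K - 1. d2 w i * d2 v i\<bar> \<le> 16 * W * (\<Sum>k\<le>K. v k)"
proof -
  have W: "0 \<le> W" using w[of 0] by linarith
  have sub: "(\<Sum>i<K - 1. v (i + j)) \<le> (\<Sum>k\<le>K. v k)" if "j \<le> 2" for j
  proof -
    have "(\<Sum>i<K - 1. v (i + j)) = (\<Sum>k\<in>(\<lambda>i. i + j) ` {..<K - 1}. v k)"
      by (subst sum.reindex) auto
    also have "\<dots> \<le> (\<Sum>k\<le>K. v k)" by (rule sum_mono2) (use that v in auto)
    finally show ?thesis .
  qed
  have "\<bar>\<Sum>i<K - 1. d2 w i * d2 v i\<bar> \<le> (\<Sum>i<K - 1. \<bar>d2 w i\<bar> * \<bar>d2 v i\<bar>)"
    using sum_abs[of "\<lambda>i. d2 w i * d2 v i" "{..<K - 1}"] by (simp add: abs_mult)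
  also have "\<dots> \<le> (\<Sum>i<K - 1. 4 * W * (v i + 2 * v (i + 1) + v (i + 2)))"
  proof (rule sum_mono)
    fix i assume "i \<in> {..<K - 1}"
    then have "\<bar>w i\<bar> \<le> W" "\<bar>w (i + 1)\<bar> \<le> W" "\<bar>w (i + 2)\<bar> \<le> W" using w by auto
    then have "\<bar>d2 w i\<bar> \<le> 4 * W" unfolding d2_def by linarith
    moreover have "\<bar>d2 v i\<bar> \<le> v i + 2 * v (i + 1) + v (i + 2)"
      unfolding d2_def using v[of i] v[of "i + 1"] v[of "i + 2"] by linarith
    ultimately show "\<bar>d2 w i\<bar> * \<bar>d2 v i\<bar> \<le> 4 * W * (v i + 2 * v (i + 1) + v (i + 2))"
      using W by (intro mult_mono) auto
  qed
  also have "\<dots> = 4 * W * ((\<Sum>i<K - 1. v (i + 0)) + 2 * (\<Sum>i<K - 1. v (i + 1)) + (\<Sum>i<K - 1. v (i + 2)))"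
    by (simp add: sum.distrib sum_distrib_left algebra_simps)
  also have "\<dots> \<le> 4 * W * (4 * (\<Sum>k\<le>K. v k))"
    using sub[of 0] sub[of 1] sub[of 2] W by (intro mult_left_mono) linarith+
  finally show ?thesis by (simp add: mult.assoc)
qed

section \<open>The maximum norm estimate for a fixed set of knots\<close>

text \<open>A discrete maximum principle: away from \<open>T\<close> a value is the mean of its two
  neighbours.\<close>

lemma max_at_knot:
  assumes T: "0 \<in> T" "K \<in> T" and w: "w \<in> knot_space T"
  obtains p where "p \<in> T" "p \<le> K" "\<And>k. k \<le> K \<Longrightarrow> \<bar>w k\<bar> \<le> \<bar>w p\<bar>"
proof -
  define W where "W = Max ((\<lambda>k. \<bar>w k\<bar>) ` {..K})"
  have le: "\<bar>w k\<bar> \<le> W" if "k \<le> K" for k using that by (simp add: W_def)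
  have "W \<in> (\<lambda>k. \<bar>w k\<bar>) ` {..K}" unfolding W_def by (rule Max_in) auto
  then have ex: "\<exists>k. k \<le> K \<and> \<bar>w k\<bar> = W" by auto
  \<comment> \<open>The leftmost maximiser has a strictly smaller left neighbour, which rules out an
    equality in the mean.\<close>
  define p where "p = (LEAST k. k \<le> K \<and> \<bar>w k\<bar> = W)"
  have p: "p \<le> K" "\<bar>w p\<bar> = W" using LeastI_ex[OF ex] by (simp_all add: p_def)
  have least: "\<bar>w k\<bar> < W" if "k < p" for k
    using not_less_Least[of k "\<lambda>k. k \<le> K \<and> \<bar>w k\<bar> = W"] that p le[of k] by (auto simp: p_def)
  have "p \<in> T"
  proof (rule ccontr)
    assume nT: "p \<notin> T"
    then have "p \<noteq> 0" "p \<noteq> K" using T by metis+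
    with p have i: "p - 1 < K - 1" "p - 1 + 1 = p" "p - 1 + 2 = p + 1" "p + 1 \<le> K" by auto
    then have "d2 w (p - 1) = 0" using w nT unfolding knot_space_def by auto
    then have "2 * w p = w (p - 1) + w (p + 1)" using i by (simp add: d2_def)
    moreover have "\<bar>w (p - 1)\<bar> < W" "\<bar>w (p + 1)\<bar> \<le> W" using least le i by auto
    ultimately show False using p(2) by linarith
  qed
  then show thesis using that p le by simp
qed

text \<open>The two ramp bounds and \<open>beta n K \<le> 2 * real M\<close> give a Gram part of at
  least \<open>w p * (r - q) / 54\<close>. The penalty is at most
  \<open>32 * lam * w p * (r - q)\<close> in modulus, and since \<open>3456 = 32 * 108\<close> it
  consumes at most half of that.\<close>

lemma form_hat_lower:
  assumes "q \<le> p" "p \<le> r" "q < r" "r \<le> K" "q < p \<or> p = 0" "p < r \<or> p = K"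
    and left: "\<And>i. q \<le> i \<Longrightarrow> i + 1 < p \<Longrightarrow> d2 w i = 0"
    and right: "\<And>i. p \<le> i \<Longrightarrow> i + 1 < r \<Longrightarrow> d2 w i = 0"
    and max: "\<And>k. k \<le> K \<Longrightarrow> \<bar>w k\<bar> \<le> w p" and lam': "lam \<le> 1 / 3456"
  shows "w p * (real r - real q) / 108 \<le> form w (hat q p r)"
proof -
  define H where "H = real r - real q"
  have H: "0 < H" using assms by (simp add: H_def)
  have W: "0 \<le> w p" using max[of p] assms by linarith
  let ?f = "\<lambda>i. S w i * S (hat q p r) i"
  have le: "q * M \<le> p * M" "p * M \<le> r * M" "r * M \<le> n" using assms by (auto simp: n_eq)
  have "sum ?f {1..n} = sum ?f {q * M + 1..r * M}"
    by (rule sum.mono_neutral_right) (use le S_hat_zero[OF assms(1,2,4,5,6)] in auto)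
  also have "\<dots> = sum ?f {q * M + 1..p * M} + sum ?f {p * M + 1..r * M}"
    using le(1,2) by (rule sum_split_ivl)
  finally have split: "sum ?f {1..n} = \<dots>" .
  have L: "w p * ((real p - real q) * real M / 27) \<le> sum ?f {q * M + 1..p * M}"
  proof (cases "q < p")
    case True
    then show ?thesis using assms by (intro left_ramp_sum left) auto
  qed (use assms in simp)
  have R: "w p * ((real r - real p) * real M / 27) \<le> sum ?f {p * M + 1..r * M}"
  proof (cases "p < r")
    case True
    then show ?thesis using assms by (intro right_ramp_sum right) auto
  qed (use assms in simp)
  have "w p * H * real M / 27 \<le> sum ?f {1..n}"
    using L R split by (simp add: H_def algebra_simps)
  moreover have "w p * H / 54 * beta n K \<le> w p * H / 54 * (2 * real M)"
    using beta_bounds W H by (intro mult_left_mono) auto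
  moreover have "w p * H / 54 * (2 * real M) = w p * H * real M / 27" by simp
  ultimately have "w p * H / 54 * beta n K \<le> sum ?f {1..n}" by linarith
  then have G: "w p * H / 54 \<le> sum ?f {1..n} / beta n K"
    using beta_bounds by (simp add: pos_le_divide_eq)
  have "\<bar>\<Sum>i<K - 1. d2 w i * d2 (hat q p r) i\<bar> \<le> 16 * w p * (\<Sum>k\<le>K. hat q p r k)"
    by (rule penalty_bound) (use max hat_bounds in auto)
  also have "\<dots> \<le> 16 * w p * (2 * H)"
    using sum_hat[of q p r] assms W by (intro mult_left_mono) (auto simp: H_def)
  finally have "lam * \<bar>\<Sum>i<K - 1. d2 w i * d2 (hat q p r) i\<bar> \<le> 1 / 3456 * (16 * w p * (2 * H))"
    using lam lam' W H by (intro mult_mono) auto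
  moreover have "- (lam * \<bar>\<Sum>i<K - 1. d2 w i * d2 (hat q p r) i\<bar>)
      \<le> lam * (\<Sum>i<K - 1. d2 w i * d2 (hat q p r) i)"
    using mult_left_mono[OF abs_ge_minus_self[of "\<Sum>i<K - 1. d2 w i * d2 (hat q p r) i"] lam]
    by simp
  ultimately have "- (w p * H / 108) \<le> lam * (\<Sum>i<K - 1. d2 w i * d2 (hat q p r) i)" by linarith
  with G have "w p * H / 108 \<le> form w (hat q p r)" unfolding form_def by linarith
  then show ?thesis by (simp add: H_def)
qed

text \<open>Both sides of the tested equation scale with \<open>r - q\<close>: at least
  \<open>w p * (r - q) / 108\<close> on the left, at most \<open>2 * Z * (r - q)\<close> on the
  right. Cancelling this factor makes the constant \<open>216 = 2 * 108\<close> independent of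
  \<open>K\<close>.\<close>

lemma knot_bound:
  assumes T: "0 \<in> T" "K \<in> T" and w: "w \<in> knot_space T"
    and eq: "\<And>v. v \<in> knot_space T \<Longrightarrow> form w v = pairing z v"
    and lam': "lam \<le> 1 / 3456" and Z: "\<And>k. k \<le> K \<Longrightarrow> \<bar>z k\<bar> \<le> Z"
    and p: "p \<in> T" "p \<le> K" and max: "\<And>k. k \<le> K \<Longrightarrow> \<bar>w k\<bar> \<le> w p"
  shows "w p \<le> 216 * Z"
proof -
  \<comment> \<open>The nearest element of \<open>T\<close> to the left of \<open>p\<close>, or
    \<open>q = p\<close> at the left end, where a half hat is used; \<open>r\<close> is chosen
    likewise on the right.\<close>
  obtain q where q: "q \<le> p" "q < p \<or> p = 0" "q < p \<Longrightarrow> q \<in> T" "\<And>t. q < t \<Longrightarrow> t < p \<Longrightarrow> t \<notin> T"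
  proof (cases "p = 0")
    case False
    define A where "A = {t\<in>T. t < p}"
    have ne: "finite A" "0 \<in> A" using T False by (auto simp: A_def)
    define q where "q = Max A"
    have "q \<in> A" unfolding q_def using ne by (intro Max_in) auto
    moreover have "t \<notin> T" if "q < t" "t < p" for t
    proof
      assume "t \<in> T"
      then have "t \<le> q" unfolding q_def using that ne(1) by (intro Max_ge) (auto simp: A_def)
      then show False using that by simp
    qed
    ultimately show ?thesis by (intro that[of q]) (auto simp: A_def)
  qed (use that[of 0] in auto)
  obtain r where r: "p \<le> r" "r \<le> K" "p < r \<or> p = K" "p < r \<Longrightarrow> r \<in> T" "\<And>t. p < t \<Longrightarrow> t < r \<Longrightarrow> t \<notin> T"
  proof (cases "p = K")
    case False
    define P where "P t \<longleftrightarrow> t \<in> T \<and> p < t" for t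
    have K': "P K" using T False p by (auto simp: P_def)
    define r where "r = (LEAST t. P t)"
    have "P r" unfolding r_def using K' by (rule LeastI)
    moreover have "r \<le> K" unfolding r_def using K' by (rule Least_le)
    moreover have "\<not> P t" if "t < r" for t
      using that not_less_Least unfolding r_def by blast
    ultimately show ?thesis by (intro that[of r]) (auto simp: P_def)
  qed (use that[of K] in auto)
  have qr: "q < r" using q r K by linarith
  have hatT: "hat q p r \<in> knot_space T"
    using q r p by (intro hat_in_knot_space) auto
  have "w p * (real r - real q) / 108 \<le> form w (hat q p r)"
  proof (rule form_hat_lower)
    fix i assume "q \<le> i" "i + 1 < p"
    then show "d2 w i = 0" using w q(4)[of "i + 1"] p by (auto simp: knot_space_def)
  next
    fix i assume "p \<le> i" "i + 1 < r"
    then show "d2 w i = 0" using w r(5)[of "i + 1"] r(2) by (auto simp: knot_space_def)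
  qed (use q r qr max lam' in auto)
  also have "\<dots> = pairing z (hat q p r)" using eq hatT by simp
  also have "\<dots> \<le> (\<Sum>k\<le>K. Z * hat q p r k)"
    unfolding pairing_def
  proof (rule sum_mono)
    fix k assume "k \<in> {..K}"
    then have "z k \<le> Z" using Z[of k] by auto
    then show "z k * hat q p r k \<le> Z * hat q p r k" using hat_bounds(1) by (rule mult_right_mono)
  qed
  also have "\<dots> = Z * (\<Sum>k\<le>K. hat q p r k)" by (simp add: sum_distrib_left)
  also have "\<dots> \<le> Z * (2 * (real r - real q))"
    using sum_hat[of q p r] q r qr Z[of 0] by (intro mult_left_mono) auto
  finally have "(w p / 108) * (real r - real q) \<le> (2 * Z) * (real r - real q)"
    by (simp add: algebra_simps)
  then have "w p / 108 \<le> 2 * Z" by (rule mult_right_le_imp_le) (use qr in simp)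
  then show ?thesis by simp
qed

lemma knot_space_add_scaled:
  "u \<in> knot_space T \<Longrightarrow> v \<in> knot_space T \<Longrightarrow> (\<lambda>k. u k + t * v k) \<in> knot_space T"
  by (simp add: knot_space_def d2_add_scaled)

text \<open>If the extreme value of \<open>w\<close> is negative, \<open>knot_bound\<close> is
  applied to the negatives of \<open>w\<close> and \<open>z\<close>.\<close>

lemma face_bound:
  assumes T: "0 \<in> T" "K \<in> T" and w: "w \<in> knot_space T"
    and eq: "\<And>v. v \<in> knot_space T \<Longrightarrow> form w v = pairing z v"
    and lam': "lam \<le> 1 / 3456" and Z: "\<And>k. k \<le> K \<Longrightarrow> \<bar>z k\<bar> \<le> Z" and k: "k \<le> K"
  shows "\<bar>w k\<bar> \<le> 216 * Z"
proof -
  obtain p where p: "p \<in> T" "p \<le> K" "\<And>k. k \<le> K \<Longrightarrow> \<bar>w k\<bar> \<le> \<bar>w p\<bar>"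
    using max_at_knot[OF T w] by blast
  have z0: "(\<lambda>_. 0) \<in> knot_space T" by (simp add: knot_space_def d2_def)
  have "\<bar>w p\<bar> \<le> 216 * Z"
  proof (cases "0 \<le> w p")
    case True
    then show ?thesis using knot_bound[OF T w eq lam' Z p(1,2)] p(3) by simp
  next
    case False
    let ?w = "\<lambda>k. 0 + (- 1) * w k" and ?z = "\<lambda>k. 0 + (- 1) * z k"
    have "form ?w v = pairing ?z v" if "v \<in> knot_space T" for v
      using eq[OF that] form_add_scaled_left[of "\<lambda>_. 0" "- 1" w v]
        pairing_add_scaled_left[of "\<lambda>_. 0" "- 1" z v]
      by (simp add: form_def pairing_def S_def d2_def)
    moreover have "?w \<in> knot_space T" using knot_space_add_scaled[OF z0 w] .
    ultimately have "?w p \<le> 216 * Z"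
      using T lam' Z p False by (intro knot_bound[of T ?w ?z Z p]) auto
    then show ?thesis using False by simp
  qed
  then show ?thesis using p(3)[OF k] by linarith
qed

section \<open>Coercivity\<close>

lemma form_ge: "(\<Sum>i = 1..n. (S u i)\<^sup>2) \<le> beta n K * form u u"
proof -
  have "0 \<le> lam * (\<Sum>i<K - 1. d2 u i * d2 u i)"
    by (rule mult_nonneg_nonneg[OF lam sum_nonneg]) simp
  then have "(\<Sum>i = 1..n. (S u i)\<^sup>2) / beta n K \<le> form u u"
    by (simp add: form_def power2_eq_square)
  then show ?thesis using beta_bounds(1) by (simp add: pos_divide_le_eq mult.commute)
qed

text \<open>The constant may depend on \<open>n\<close> and \<open>K\<close>: this bound serves only existence and continuity of the
  minimiser. The entry \<open>u 0\<close> needs a separate argument because the left end is not a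
  design point.\<close>

lemma coord_bound:
  assumes "k \<le> K"
  shows "(u k)\<^sup>2 \<le> 5 * beta n K * form u u"
proof -
  define Q where "Q = (\<Sum>i = 1..n. (S u i)\<^sup>2)"
  have Q: "(S u i)\<^sup>2 \<le> Q" if "1 \<le> i" "i \<le> n" for i
    unfolding Q_def by (rule member_le_sum[of i "{1..n}" "\<lambda>i. (S u i)\<^sup>2"]) (use that in auto)
  have Q0: "0 \<le> Q" by (simp add: Q_def sum_nonneg)
  have pos: "(u j)\<^sup>2 \<le> Q" if "1 \<le> j" "j \<le> K" for j
  proof -
    have "1 * 1 \<le> j * M" using that M by (intro mult_le_mono) auto
    then show ?thesis using Q[of "j * M"] S_node[of j u] that by (simp add: n_eq)
  qed
  have "(u 0)\<^sup>2 \<le> 5 * Q"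
  proof -
    \<comment> \<open>The first design point lies a fraction \<open>m \<le> 1 / 3\<close> into the
      first knot interval, so \<open>u 0\<close> is recovered from \<open>S u 1\<close> and
      \<open>u 1\<close>. The constant is \<open>5 = (9 / 4) * (2 + 2 / 9)\<close>.\<close>
    define m where "m = 1 / real M"
    have m: "0 \<le> m" "m \<le> 1 / 3" using M by (simp_all add: m_def field_simps)
    have "S u 1 = (1 - m) * u 0 + m * u 1"
      using S_interp[of 0 1 u] M K by (simp add: m_def)
    then have s: "(1 - m) * u 0 = S u 1 - m * u 1" by simp
    have n1: "1 \<le> n" using K M by (simp add: n_eq)
    have "(2 / 3)\<^sup>2 * (u 0)\<^sup>2 \<le> (1 - m)\<^sup>2 * (u 0)\<^sup>2"
      using m by (intro mult_right_mono power_mono) auto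
    also have "\<dots> = (S u 1 - m * u 1)\<^sup>2" by (simp only: s power_mult_distrib[symmetric])
    also have "\<dots> \<le> 2 * (S u 1)\<^sup>2 + 2 * (m\<^sup>2 * (u 1)\<^sup>2)"
      using zero_le_power2[of "S u 1 + m * u 1"] by (simp add: power2_eq_square algebra_simps)
    also have "\<dots> \<le> 2 * Q + 2 * ((1 / 3)\<^sup>2 * Q)"
      using m Q[of 1] n1 pos[of 1] K by (intro add_mono mult_left_mono mult_mono power_mono) auto
    finally show ?thesis by (simp add: power2_eq_square)
  qed
  then have "(u k)\<^sup>2 \<le> 5 * Q" using pos[of k] assms Q0 by (cases "k = 0") auto
  then show ?thesis using form_ge[of u] by (simp add: Q_def)
qed

text \<open>Young's inequality in each coordinate; the weight is chosen so that the
  \<open>K + 1\<close> terms together use up half of \<open>form u u\<close>.\<close>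

lemma pairing_le:
  "pairing y u \<le> (5 * beta n K * (real K + 1)) * (\<Sum>k\<le>K. (y k)\<^sup>2) / 2 + form u u / 2"
proof -
  define a where "a = 5 * beta n K * (real K + 1)"
  have a: "0 < a" using beta_bounds(1) by (simp add: a_def)
  have "pairing y u \<le> (\<Sum>k\<le>K. a * (y k)\<^sup>2 / 2 + form u u / (2 * (real K + 1)))"
    unfolding pairing_def
  proof (rule sum_mono)
    fix k assume "k \<in> {..K}"
    then have "(u k)\<^sup>2 / a \<le> 5 * beta n K * form u u / a"
      using coord_bound[of k u] a by (simp add: divide_right_mono)
    also have "\<dots> = form u u / (real K + 1)"
      using beta_bounds(1) by (simp add: a_def)
    finally have *: "(u k)\<^sup>2 / a \<le> form u u / (real K + 1)" .
    have "form u u / (2 * (real K + 1)) = form u u / (real K + 1) / 2" by simp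
    with young[OF a *, of "y k"]
    show "y k * u k \<le> a * (y k)\<^sup>2 / 2 + form u u / (2 * (real K + 1))" by (simp only:)
  qed
  also have "\<dots> = a * (\<Sum>k\<le>K. (y k)\<^sup>2) / 2 + form u u / 2"
    by (simp add: sum.distrib sum_distrib_left sum_divide_distrib[symmetric] field_simps)
  finally show ?thesis by (simp add: a_def)
qed

section \<open>Existence of a minimiser\<close>

definition obj :: "(nat \<Rightarrow> real) \<Rightarrow> (nat \<Rightarrow> real) \<Rightarrow> real" where
  "obj y u = form u u / 2 - pairing y u"

definition cone :: "(nat \<Rightarrow> real) set" where
  "cone = {u. \<forall>i<K - 1. 0 \<le> d2 u i}"

definition is_min :: "(nat \<Rightarrow> real) \<Rightarrow> (nat \<Rightarrow> real) \<Rightarrow> bool" where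
  "is_min y u \<longleftrightarrow> u \<in> cone \<and> (\<forall>c\<in>cone. obj y u \<le> obj y c)"

lemma obj_line:
  "obj y (\<lambda>k. u k + t * d k) = obj y u + t * (form u d - pairing y d) + t\<^sup>2 / 2 * form d d"
proof -
  have "form (\<lambda>k. u k + t * d k) (\<lambda>k. u k + t * d k) = form u u + 2 * t * form u d + t\<^sup>2 * form d d"
    unfolding form_add_scaled_left form_add_scaled_right using form_sym[of d u]
    by (simp add: power2_eq_square algebra_simps)
  then show ?thesis by (simp add: obj_def pairing_add_scaled_right algebra_simps)
qed

text \<open>Convexity of the cone. Differences are written \<open>c k + (- 1) * u k\<close> so that
  the rules for \<open>u k + t * v k\<close> apply to them.\<close>

lemma cone_segment:
  assumes "u \<in> cone" "c \<in> cone" "0 \<le> t" "t \<le> 1"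
  shows "(\<lambda>k. u k + t * (c k + (- 1) * u k)) \<in> cone"
  unfolding cone_def
proof (clarify)
  fix i assume i: "i < K - 1"
  have "d2 (\<lambda>k. u k + t * (c k + (- 1) * u k)) i = (1 - t) * d2 u i + t * d2 c i"
    unfolding d2_add_scaled by (simp add: algebra_simps)
  also have "0 \<le> \<dots>" using assms i by (auto simp: cone_def)
  finally show "0 \<le> d2 (\<lambda>k. u k + t * (c k + (- 1) * u k)) i" .
qed

text \<open>The parallelogram law: two points whose objective values are close to the infimum are
  close in energy once their midpoint is feasible.\<close>

lemma obj_parallelogram:
  fixes u c y
  defines "d \<equiv> \<lambda>k. c k + (- 1) * u k"
  shows "form d d = 4 * obj y u + 4 * obj y c - 8 * obj y (\<lambda>k. u k + 1 / 2 * d k)"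
proof -
  define g where "g = form u d - pairing y d"
  have "(\<lambda>k. u k + 1 * d k) = c" by (simp add: d_def)
  then have "obj y c = obj y u + g + form d d / 2"
    using obj_line[of y u 1 d] by (simp add: g_def)
  moreover have "obj y (\<lambda>k. u k + 1 / 2 * d k) = obj y u + g / 2 + form d d / 8"
    using obj_line[of y u "1 / 2" d] by (simp add: g_def power2_eq_square)
  ultimately show ?thesis by simp
qed

lemma tendsto_d2:
  "(\<And>k. k \<le> K \<Longrightarrow> (\<lambda>i. u i k) \<longlonglongrightarrow> b k) \<Longrightarrow> j < K - 1 \<Longrightarrow> (\<lambda>i. d2 (u i) j) \<longlonglongrightarrow> d2 b j"
  unfolding d2_def by (intro tendsto_intros) auto

lemma tendsto_obj:
  assumes "\<And>k. k \<le> K \<Longrightarrow> (\<lambda>i. u i k) \<longlonglongrightarrow> b k"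
  shows "(\<lambda>i. obj y (u i)) \<longlonglongrightarrow> obj y b"
proof -
  have "(\<lambda>i. S (u i) j) \<longlonglongrightarrow> S b j" for j
    unfolding S_def by (intro tendsto_intros assms) auto
  then have "(\<lambda>i. form (u i) (u i)) \<longlonglongrightarrow> form b b"
    unfolding form_def using beta_bounds(1)
    by (intro tendsto_intros tendsto_d2 assms) auto
  moreover have "(\<lambda>i. pairing y (u i)) \<longlonglongrightarrow> pairing y b"
    unfolding pairing_def by (intro tendsto_intros assms) auto
  ultimately show ?thesis unfolding obj_def by (intro tendsto_intros) auto
qed

lemma minimizing_Cauchy:
  assumes u: "\<And>i. u i \<in> cone" "\<And>i. obj y (u i) < m + inverse (real (Suc i))"
    and m: "\<And>c. c \<in> cone \<Longrightarrow> m \<le> obj y c" and k: "k \<le> K"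
  shows "Cauchy (\<lambda>i. u i k)"
proof (rule metric_CauchyI)
  fix e :: real assume e: "0 < e"
  define C where "C = 5 * beta n K"
  have C: "0 < C" using beta_bounds(1) by (simp add: C_def)
  obtain N where N: "inverse (real (Suc N)) < e\<^sup>2 / (8 * C)"
    using reals_Archimedean[of "e\<^sup>2 / (8 * C)"] e C by auto
  have "dist (u i k) (u j k) < e" if ij: "N \<le> i" "N \<le> j" for i j
  proof -
    let ?d = "\<lambda>k. u j k + (- 1) * u i k"
    have "m \<le> obj y (\<lambda>k. u i k + 1 / 2 * ?d k)"
      using u by (intro m cone_segment) auto
    moreover have "inverse (real (Suc i)) \<le> inverse (real (Suc N))"
      "inverse (real (Suc j)) \<le> inverse (real (Suc N))"
      using ij by auto
    ultimately have "form ?d ?d \<le> 8 * inverse (real (Suc N))"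
      unfolding obj_parallelogram[where y = y] using u(2)[of i] u(2)[of j] by linarith
    also have "\<dots> < 8 * (e\<^sup>2 / (8 * C))" using N by simp
    finally have "C * form ?d ?d < e\<^sup>2" using C by (simp add: field_simps)
    then have "(u j k - u i k)\<^sup>2 < e\<^sup>2" using coord_bound[OF k, of ?d] by (simp add: C_def)
    then have "\<bar>u j k - u i k\<bar> < e" using e by (simp add: power2_less_imp_less abs_if power2_commute)
    then show ?thesis by (simp add: dist_real_def abs_minus_commute)
  qed
  then show "\<exists>N. \<forall>i\<ge>N. \<forall>j\<ge>N. dist (u i k) (u j k) < e" by blast
qed

text \<open>The direct method: \<open>pairing_le\<close> bounds the objective below, a minimising
  sequence converges in each coordinate, and both the cone and the objective pass to the
  limit.\<close>

lemma ex_min: "\<exists>b. is_min y b"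
proof -
  define m where "m = Inf (obj y ` cone)"
  have "(\<lambda>_. 0) \<in> cone" by (simp add: cone_def d2_def)
  then have ne: "obj y ` cone \<noteq> {}" by blast
  have bdd: "bdd_below (obj y ` cone)"
  proof (rule bdd_belowI2)
    fix u show "- ((5 * beta n K * (real K + 1)) * (\<Sum>k\<le>K. (y k)\<^sup>2) / 2) \<le> obj y u"
      using pairing_le[of y u] by (simp add: obj_def)
  qed
  have m: "m \<le> obj y c" if "c \<in> cone" for c
    unfolding m_def using that bdd by (intro cInf_lower) auto
  have "\<exists>c\<in>cone. obj y c < m + inverse (real (Suc i))" for i
    using cInf_lessD[OF ne, of "m + inverse (real (Suc i))"] by (auto simp: m_def)
  then obtain u where u: "\<And>i. u i \<in> cone" "\<And>i. obj y (u i) < m + inverse (real (Suc i))"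
    by metis
  \<comment> \<open>Convergence is known only for \<open>k \<le> K\<close>, and these are the
    coordinates that \<open>obj\<close> and \<open>cone\<close> read.\<close>
  define b where "b k = lim (\<lambda>i. u i k)" for k
  have lim: "(\<lambda>i. u i k) \<longlonglongrightarrow> b k" if "k \<le> K" for k
    using minimizing_Cauchy[OF u m that] unfolding b_def
    by (simp add: Cauchy_convergent_iff convergent_LIMSEQ_iff)
  have "b \<in> cone"
    unfolding cone_def
  proof (clarify)
    fix j assume "j < K - 1"
    then show "0 \<le> d2 b j"
      using u(1) by (intro LIMSEQ_le_const[OF tendsto_d2[OF lim]]) (auto simp: cone_def)
  qed
  moreover have "obj y b \<le> m"
  proof (rule LIMSEQ_le[OF tendsto_obj[OF lim]])
    show "(\<lambda>i. m + inverse (real (Suc i))) \<longlonglongrightarrow> m"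
      using tendsto_add[OF tendsto_const[of m] LIMSEQ_inverse_real_of_nat] by simp
  qed (use u(2) less_imp_le in auto)
  ultimately have "is_min y b" using m by (fastforce simp: is_min_def)
  then show ?thesis by blast
qed

section \<open>Optimality conditions\<close>

text \<open>The increment of the objective along a feasible direction is divided by
  \<open>t\<close>, and \<open>t\<close> tends to 0 from the right.\<close>

lemma min_direction:
  assumes b: "is_min y b" and ev: "\<forall>\<^sub>F t in at_right 0. (\<lambda>k. b k + t * d k) \<in> cone"
  shows "pairing y d \<le> form b d"
proof -
  let ?g = "form b d - pairing y d"
  have ev': "\<forall>\<^sub>F t in at_right 0. 0 \<le> ?g + t / 2 * form d d"
    using ev eventually_at_right_less[of "0 :: real"]
  proof eventually_elim
    case (elim t)
    have "0 \<le> t * ?g + t\<^sup>2 / 2 * form d d"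
      using b elim(1) obj_line[of y b t d] by (fastforce simp: is_min_def)
    then have "0 \<le> t * (?g + t / 2 * form d d)" by (simp add: power2_eq_square algebra_simps)
    then show ?case using elim(2) by (simp add: zero_le_mult_iff)
  qed
  have "((\<lambda>t. ?g + t / 2 * form d d) \<longlongrightarrow> ?g + 0 / 2 * form d d) (at_right 0)"
    by (intro tendsto_intros) auto
  from tendsto_lowerbound[OF this ev'] have "0 \<le> ?g + 0 / 2 * form d d" by simp
  then show ?thesis by simp
qed

lemma min_variational:
  assumes b: "is_min y b" and c: "c \<in> cone"
  shows "pairing y (\<lambda>k. c k + (- 1) * b k) \<le> form b (\<lambda>k. c k + (- 1) * b k)"
proof (rule min_direction[OF b])
  show "\<forall>\<^sub>F t in at_right 0. (\<lambda>k. b k + t * (c k + (- 1) * b k)) \<in> cone"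
    by (rule eventually_at_rightI[of 0 1]) (use b c cone_segment in \<open>auto simp: is_min_def\<close>)
qed

lemma min_face:
  assumes b: "is_min y b"
  obtains T where "T \<subseteq> {..K}" "0 \<in> T" "K \<in> T" "b \<in> knot_space T"
    "\<And>v. v \<in> knot_space T \<Longrightarrow> form b v = pairing y v"
proof -
  define T where "T = {0, K} \<union> {i + 1 | i. i < K - 1 \<and> d2 b i \<noteq> 0}"
  have one: "pairing y v \<le> form b v" if v: "v \<in> knot_space T" for v
  proof (rule min_direction[OF b])
    \<comment> \<open>Zero second differences stay zero because \<open>v\<close> has no kink there;
      positive ones stay positive for small \<open>t\<close>.\<close>
    have "\<forall>\<^sub>F t in at_right 0. \<forall>i\<in>{..<K - 1}. 0 \<le> d2 (\<lambda>k. b k + t * v k) i"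
    proof (rule eventually_ball_finite, simp, rule ballI)
      fix i assume i: "i \<in> {..<K - 1}"
      show "\<forall>\<^sub>F t in at_right 0. 0 \<le> d2 (\<lambda>k. b k + t * v k) i"
      proof (cases "d2 b i = 0")
        case True
        then have "i + 1 \<notin> T" using i by (auto simp: T_def)
        then have "d2 v i = 0" using v i by (simp add: knot_space_def)
        then show ?thesis using True by (simp add: d2_add_scaled)
      next
        case False
        then have pos: "0 < d2 b i + 0 * d2 v i" using b i by (auto simp: is_min_def cone_def less_le)
        have "((\<lambda>t. d2 b i + t * d2 v i) \<longlongrightarrow> d2 b i + 0 * d2 v i) (at_right 0)"
          by (intro tendsto_intros)
        from order_tendstoD(1)[OF this pos] show ?thesis
          unfolding d2_add_scaled by eventually_elim simp
      qed
    qed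
    then show "\<forall>\<^sub>F t in at_right 0. (\<lambda>k. b k + t * v k) \<in> cone"
      by eventually_elim (simp add: cone_def)
  qed
  have "form b v = pairing y v" if v: "v \<in> knot_space T" for v
  proof (rule antisym)
    \<comment> \<open>This is the negative of \<open>v\<close>; it yields the reverse
      inequality.\<close>
    have "(\<lambda>k. v k + (- 2) * v k) \<in> knot_space T" by (rule knot_space_add_scaled[OF v v])
    from one[OF this] show "form b v \<le> pairing y v"
      unfolding form_add_scaled_right pairing_add_scaled_right by simp
  qed (rule one[OF v])
  moreover have "b \<in> knot_space T" by (auto simp: knot_space_def T_def)
  moreover have "T \<subseteq> {..K}" "0 \<in> T" "K \<in> T" by (auto simp: T_def)
  ultimately show thesis using that by blast
qed

section \<open>Lipschitz dependence along a segment of data\<close>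

text \<open>Adding the two variational inequalities gives
  \<open>form d d \<le> t * pairing h d\<close>; \<open>pairing_le\<close> allows half of
  \<open>form d d\<close> to be absorbed on the left. The constant depends on \<open>n\<close> and
  \<open>K\<close>, which is enough for continuity in \<open>t\<close>.\<close>

lemma min_continuity_bound:
  assumes b: "is_min y b" and c: "is_min (\<lambda>k. y k + t * h k) c" and k: "k \<le> K"
  shows "(c k - b k)\<^sup>2 \<le> t\<^sup>2 * ((5 * beta n K)\<^sup>2 * (real K + 1) * (\<Sum>k\<le>K. (h k)\<^sup>2))"
proof -
  define d where "d = (\<lambda>k. c k + (- 1) * b k)"
  have d': "(\<lambda>k. b k + (- 1) * c k) = (\<lambda>k. 0 + (- 1) * d k)" by (auto simp: d_def)
  have z: "form x (\<lambda>_. 0) = 0" "pairing x (\<lambda>_. 0) = 0" for x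
    by (simp_all add: form_def pairing_def S_def d2_def)
  have "pairing y d \<le> form b d"
    using min_variational[OF b] c by (simp add: is_min_def d_def)
  moreover have "form c d \<le> pairing y d + t * pairing h d"
    using min_variational[OF c, of b] b
    unfolding d' form_add_scaled_right pairing_add_scaled_right pairing_add_scaled_left by (simp add: is_min_def z)
  moreover have "form d d = form c d - form b d"
    using form_add_scaled_left[of c "-1" b d] by (simp add: d_def)
  ultimately have "form d d \<le> t * pairing h d" by linarith
  also have "\<dots> = pairing (\<lambda>k. 0 + t * h k) d"
    unfolding pairing_add_scaled_left by (simp add: pairing_def)
  also have "\<dots> \<le> (5 * beta n K * (real K + 1)) * (\<Sum>k\<le>K. (0 + t * h k)\<^sup>2) / 2 + form d d / 2"
    by (rule pairing_le)
  finally have "form d d \<le> (5 * beta n K * (real K + 1)) * (t\<^sup>2 * (\<Sum>k\<le>K. (h k)\<^sup>2))"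
    by (simp add: power_mult_distrib sum_distrib_left)
  then have "5 * beta n K * form d d
      \<le> 5 * beta n K * ((5 * beta n K * (real K + 1)) * (t\<^sup>2 * (\<Sum>k\<le>K. (h k)\<^sup>2)))"
    using beta_bounds(1) by (intro mult_left_mono) auto
  then have "(d k)\<^sup>2 \<le> 5 * beta n K * ((5 * beta n K * (real K + 1)) * (t\<^sup>2 * (\<Sum>k\<le>K. (h k)\<^sup>2)))"
    using coord_bound[OF k, of d] by linarith
  then show ?thesis by (simp add: d_def power2_eq_square algebra_simps)
qed

lemma min_lipschitz:
  assumes G: "\<And>t. is_min (\<lambda>k. a k + t * h k) (G t)" and lam': "lam \<le> 1 / 3456"
    and h: "\<And>k. k \<le> K \<Longrightarrow> \<bar>h k\<bar> \<le> Z" and k: "k \<le> K"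
  shows "\<bar>G 1 k - G 0 k\<bar> \<le> 216 * Z"
proof -
  have Z: "0 \<le> Z" using h[of 0] by linarith
  have cont: "continuous_on UNIV (\<lambda>t. G t k)" if "k \<le> K" for k
  proof -
    define L where "L = (5 * beta n K)\<^sup>2 * (real K + 1) * (\<Sum>k\<le>K. (h k)\<^sup>2)"
    have L: "0 \<le> L" by (simp add: L_def sum_nonneg)
    have "(sqrt L)-lipschitz_on UNIV (\<lambda>t. G t k)"
    proof (rule lipschitz_onI)
      fix s t
      have "is_min (\<lambda>k. (a k + t * h k) + (s - t) * h k) (G s)"
        using G[of s] by (simp add: algebra_simps)
      from min_continuity_bound[OF G this that]
      have "(G s k - G t k)\<^sup>2 \<le> (s - t)\<^sup>2 * L" by (simp add: L_def)
      then have "sqrt ((G s k - G t k)\<^sup>2) \<le> sqrt ((s - t)\<^sup>2 * L)"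
        by (rule real_sqrt_le_mono)
      then show "dist (G s k) (G t k) \<le> sqrt L * dist s t"
        by (simp add: real_sqrt_mult dist_real_def mult.commute)
    qed (use L in simp)
    then show ?thesis by (rule lipschitz_on_continuous_on)
  qed
  \<comment> \<open>The parameters whose minimiser satisfies the equations of \<open>T\<close>.
    Continuity of \<open>G\<close> makes each \<open>U T\<close> closed, being an intersection of
    solution sets of continuous equations.\<close>
  define U where "U T = {t. G t \<in> knot_space T
      \<and> (\<forall>v\<in>knot_space T. form (G t) v = pairing (\<lambda>k. a k + t * h k) v)}" for T
  have closed: "closed (U T)" for T
  proof -
    have "continuous_on UNIV (\<lambda>t. d2 (G t) i)" if "i < K - 1" for i
      unfolding d2_def using that by (intro continuous_intros cont) auto
    moreover have "continuous_on UNIV (\<lambda>t. form (G t) v)" for v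
      unfolding form_def S_def d2_def using beta_bounds(1) by (intro continuous_intros cont) auto
    moreover have "continuous_on UNIV (\<lambda>t. pairing (\<lambda>k. a k + t * h k) v)" for v
      unfolding pairing_add_scaled_left by (intro continuous_intros)
    ultimately have "closed ((\<Inter>i\<in>{i. i < K - 1 \<and> i + 1 \<notin> T}. {t. d2 (G t) i = 0})
        \<inter> (\<Inter>v\<in>knot_space T. {t. form (G t) v = pairing (\<lambda>k. a k + t * h k) v}))"
      by (intro closed_Int closed_INT ballI closed_Collect_eq continuous_on_const) auto
    also have "\<dots> = U T" by (auto simp: U_def knot_space_def)
    finally show ?thesis .
  qed
  have lip: "(216 * Z)-lipschitz_on (U T) (\<lambda>t. G t k)" if T: "0 \<in> T" "K \<in> T" for T
  proof (rule lipschitz_onI)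
    fix s t assume st: "s \<in> U T" "t \<in> U T"
    let ?w = "\<lambda>k. G s k + (- 1) * G t k"
    let ?z = "\<lambda>k. (a k + s * h k) + (- 1) * (a k + t * h k)"
    \<comment> \<open>Within one \<open>U T\<close> the two systems of equations can be subtracted,
      and the data differ by \<open>(s - t) * h k\<close>.\<close>
    have "\<bar>?w k\<bar> \<le> 216 * (\<bar>s - t\<bar> * Z)"
    proof (rule face_bound[OF T])
      show "?w \<in> knot_space T" using st by (intro knot_space_add_scaled) (auto simp: U_def)
      show "form ?w v = pairing ?z v" if "v \<in> knot_space T" for v
        unfolding form_add_scaled_left pairing_add_scaled_left[where y = "\<lambda>k. a k + s * h k"
            and z = "\<lambda>k. a k + t * h k"]
        using st that by (simp add: U_def)
      show "\<bar>?z k\<bar> \<le> \<bar>s - t\<bar> * Z" if "k \<le> K" for k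
      proof -
        have "?z k = (s - t) * h k" by (simp add: algebra_simps)
        then show ?thesis using h[OF that] by (simp add: abs_mult mult_left_mono)
      qed
    qed (use lam' k in auto)
    then show "dist (G s k) (G t k) \<le> 216 * Z * dist s t"
      by (simp add: dist_real_def mult_ac)
  qed (use Z in simp)
  define I where "I = {T. T \<subseteq> {..K} \<and> 0 \<in> T \<and> K \<in> T}"
  \<comment> \<open>A continuous function on a segment covered by finitely many closed sets inherits
    their common Lipschitz constant.\<close>
  have "(216 * Z)-lipschitz_on {0..1} (\<lambda>t. G t k)"
  proof (rule lipschitz_on_closed_Union[where I = I and U = U])
    show "finite I" unfolding I_def by simp
    show "{0..1} \<subseteq> (\<Union>T\<in>I. U T)"
    proof
      fix t :: real
      obtain T where "T \<subseteq> {..K}" "0 \<in> T" "K \<in> T" "G t \<in> knot_space T"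
        "\<And>v. v \<in> knot_space T \<Longrightarrow> form (G t) v = pairing (\<lambda>k. a k + t * h k) v"
        using min_face[OF G[of t]] by blast
      then show "t \<in> (\<Union>T\<in>I. U T)" by (auto simp: I_def U_def)
    qed
  qed (use lip closed Z in \<open>auto simp: I_def\<close>)
  from lipschitz_onD[OF this, of 1 0] show ?thesis by (simp add: dist_real_def)
qed

section \<open>Translation between matrices and functions\<close>

lemma design_mult:
  "i < n \<Longrightarrow> c \<in> carrier_vec (K + 1) \<Longrightarrow>
    vec_index (design_mat n K *\<^sub>v c) i = S (vec_index c) (i + 1)"
  by (simp add: design_mat_def scalar_prod_def S_def atLeast0LessThan lessThan_Suc_atMost
      del: sum.op_ivl_Suc sum.lessThan_Suc)

lemma diff2_mult:
  assumes "i < K - 1" "c \<in> carrier_vec (K + 1)"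
  shows "vec_index (diff2_mat K *\<^sub>v c) i = d2 (vec_index c) i"
proof -
  let ?f = "\<lambda>j. (if j = i then 1 else if j = i + 1 then - 2 else if j = i + 2 then 1 else 0) * vec_index c j"
  have "vec_index (diff2_mat K *\<^sub>v c) i = sum ?f {0..<K + 1}"
    using assms by (auto simp: diff2_mat_def scalar_prod_def intro!: sum.cong)
  also have "\<dots> = sum ?f {i, i + 1, i + 2}"
    using assms(1) by (intro sum.mono_neutral_right) auto
  finally show ?thesis by (simp add: d2_def)
qed

lemma scalar_Lambda:
  assumes b: "b \<in> carrier_vec (K + 1)" and c: "c \<in> carrier_vec (K + 1)"
  shows "scalar_prod b (Lambda_mat n K lam *\<^sub>v c) = form (vec_index b) (vec_index c)"
proof -
  let ?X = "design_mat n K" and ?D = "diff2_mat K"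
  have X: "?X \<in> carrier_mat n (K + 1)" by (simp add: design_mat_def)
  have D: "?D \<in> carrier_mat (K - 1) (K + 1)" by (simp add: diff2_mat_def)
  have XX: "transpose_mat ?X * ?X \<in> carrier_mat (K + 1) (K + 1)" using X by auto
  have DD: "transpose_mat ?D * ?D \<in> carrier_mat (K + 1) (K + 1)" using D by auto
  have "Lambda_mat n K lam *\<^sub>v c
      = (1 / beta n K) \<cdot>\<^sub>v ((transpose_mat ?X * ?X) *\<^sub>v c) + lam \<cdot>\<^sub>v ((transpose_mat ?D * ?D) *\<^sub>v c)"
    unfolding Lambda_mat_def Gamma_mat_def using XX DD c
    by (subst add_mult_distrib_mat_vec[of _ "K + 1" "K + 1"])
      (auto simp: smult_mat_mult_vec[OF XX c] smult_mat_mult_vec[OF DD c] simp del: assoc_mult_mat_vec)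
  then have "scalar_prod b (Lambda_mat n K lam *\<^sub>v c)
      = 1 / beta n K * scalar_prod b ((transpose_mat ?X * ?X) *\<^sub>v c)
        + lam * scalar_prod b ((transpose_mat ?D * ?D) *\<^sub>v c)"
    using XX DD b c
    by (simp add: scalar_prod_add_distrib[of _ "K + 1"] del: assoc_mult_mat_vec)
  also have "\<dots> = 1 / beta n K * (\<Sum>i<n. S (vec_index b) (i + 1) * S (vec_index c) (i + 1))
      + lam * (\<Sum>i<K - 1. d2 (vec_index b) i * d2 (vec_index c) i)"
    unfolding scalar_prod_transpose_mult[OF X b c] scalar_prod_transpose_mult[OF D b c]
    using b c by (simp add: design_mult diff2_mult)
  also have "\<dots> = form (vec_index b) (vec_index c)"
    by (simp add: form_def sum.atLeast1_atMost_eq)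
  finally show ?thesis .
qed

lemma objective_eq:
  assumes b: "b \<in> carrier_vec (K + 1)" and y: "y \<in> carrier_vec (K + 1)"
  shows "1 / 2 * scalar_prod b (Lambda_mat n K lam *\<^sub>v b) - scalar_prod b y
    = obj (vec_index y) (vec_index b)"
proof -
  have "scalar_prod b y = pairing (vec_index y) (vec_index b)"
    using y by (simp add: scalar_prod_def pairing_def atLeast0LessThan lessThan_Suc_atMost mult.commute)
  then show ?thesis by (simp add: scalar_Lambda[OF b b] obj_def)
qed

lemma Omega_iff:
  "b \<in> Omega K \<longleftrightarrow> b \<in> carrier_vec (K + 1) \<and> vec_index b \<in> cone"
proof -
  have "diff2_mat K *\<^sub>v b \<ge> 0\<^sub>v (K - 1) \<longleftrightarrow> vec_index b \<in> cone" if "b \<in> carrier_vec (K + 1)"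
  proof -
    have "dim_vec (diff2_mat K *\<^sub>v b) = K - 1" by (simp add: diff2_mat_def)
    then have "diff2_mat K *\<^sub>v b \<ge> 0\<^sub>v (K - 1)
        \<longleftrightarrow> (\<forall>i<K - 1. 0 \<le> vec_index (diff2_mat K *\<^sub>v b) i)"
      unfolding Matrix.less_eq_vec_def by (simp del: index_mult_mat_vec dim_mult_mat_vec)
    also have "\<dots> \<longleftrightarrow> vec_index b \<in> cone"
      using diff2_mult[OF _ that] by (simp add: cone_def del: index_mult_mat_vec)
    finally show ?thesis .
  qed
  then show ?thesis by (auto simp: Omega_def)
qed

lemma d2_cong: "(\<And>k. k \<le> K \<Longrightarrow> u k = v k) \<Longrightarrow> i < K - 1 \<Longrightarrow> d2 u i = d2 v i"
  by (simp add: d2_def)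

lemma obj_cong: "(\<And>k. k \<le> K \<Longrightarrow> u k = v k) \<Longrightarrow> obj y u = obj y v"
proof -
  assume eq: "\<And>k. k \<le> K \<Longrightarrow> u k = v k"
  then have "S u i = S v i" for i by (auto simp: S_def intro!: sum.cong)
  moreover have "d2 u i = d2 v i" if "i < K - 1" for i using d2_cong[OF eq that] .
  moreover have "pairing y u = pairing y v" using eq by (auto simp: pairing_def intro!: sum.cong)
  ultimately show ?thesis by (simp add: obj_def form_def)
qed

text \<open>\<open>arg_min_on\<close> returns a minimiser only if one exists. The minimiser from
  \<open>ex_min\<close> is cut down to a vector of dimension \<open>K + 1\<close>, which changes
  neither feasibility nor the objective.\<close>

lemma bhat_is_min:
  assumes y: "y \<in> carrier_vec (K + 1)"
  shows "bhat n K lam y \<in> carrier_vec (K + 1)" "is_min (vec_index y) (vec_index (bhat n K lam y))"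
proof -
  define f where "f b = 1 / 2 * scalar_prod b (Lambda_mat n K lam *\<^sub>v b) - scalar_prod b y" for b
  have f: "f b = obj (vec_index y) (vec_index b)" if "b \<in> carrier_vec (K + 1)" for b
    unfolding f_def by (rule objective_eq[OF that y])
  let ?vec = "Matrix.vec (K + 1)"
  have in_Omega: "?vec c \<in> Omega K" "obj (vec_index y) (vec_index (?vec c)) = obj (vec_index y) c"
    if "c \<in> cone" for c
  proof -
    have eq: "vec_index (?vec c) k = c k" if "k \<le> K" for k using that by simp
    show "obj (vec_index y) (vec_index (?vec c)) = obj (vec_index y) c"
      using eq by (rule obj_cong)
    show "?vec c \<in> Omega K"
      using \<open>c \<in> cone\<close> d2_cong[OF eq] by (auto simp: Omega_iff cone_def)
  qed
  obtain b where b: "is_min (vec_index y) b" using ex_min by blast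
  have "is_arg_min f (\<lambda>x. x \<in> Omega K) (?vec b)"
    unfolding is_arg_min_linorder
  proof (intro conjI allI impI)
    show "?vec b \<in> Omega K" using b in_Omega by (simp add: is_min_def)
    fix c assume c: "c \<in> Omega K"
    then show "f (?vec b) \<le> f c"
      using b in_Omega[of b] by (simp add: f Omega_iff is_min_def)
  qed
  then have "is_arg_min f (\<lambda>x. x \<in> Omega K) (bhat n K lam y)"
    unfolding bhat_def f_def[abs_def, symmetric] arg_min_on_def arg_min_def by (rule someI)
  then have min: "bhat n K lam y \<in> Omega K" "\<And>c. c \<in> Omega K \<Longrightarrow> f (bhat n K lam y) \<le> f c"
    by (auto simp: is_arg_min_linorder)
  then show carrier: "bhat n K lam y \<in> carrier_vec (K + 1)" by (simp add: Omega_iff)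
  show "is_min (vec_index y) (vec_index (bhat n K lam y))"
    unfolding is_min_def
  proof (intro conjI ballI)
    show "vec_index (bhat n K lam y) \<in> cone" using min(1) by (simp add: Omega_iff)
    fix c assume c: "c \<in> cone"
    have "f (bhat n K lam y) \<le> f (?vec c)" by (rule min(2)[OF in_Omega(1)[OF c]])
    then show "obj (vec_index y) (vec_index (bhat n K lam y)) \<le> obj (vec_index y) c"
      using in_Omega[OF c] carrier by (simp add: f)
  qed
qed

text \<open>Entries of a vector beyond its dimension are unspecified, so two descriptions of the
  same data are only known to agree up to \<open>K\<close>.\<close>

lemma is_min_cong: "(\<And>k. k \<le> K \<Longrightarrow> x k = y k) \<Longrightarrow> is_min x u \<Longrightarrow> is_min y u"
proof -
  assume "\<And>k. k \<le> K \<Longrightarrow> x k = y k" and u: "is_min x u"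
  then have "obj x c = obj y c" for c by (simp add: obj_def pairing_def)
  with u show ?thesis by (simp add: is_min_def)
qed

lemma bhat_lipschitz:
  assumes y1: "y1 \<in> carrier_vec (K + 1)" and y2: "y2 \<in> carrier_vec (K + 1)"
    and lam': "lam \<le> 1 / 3456"
  shows "max_norm (bhat n K lam y1 - bhat n K lam y2) \<le> 216 * max_norm (y1 - y2)"
proof -
  define h where "h = y1 - y2"
  have h: "h \<in> carrier_vec (K + 1)" using y1 y2 by (simp add: h_def)
  \<comment> \<open>The segment runs from \<open>y2\<close> at \<open>t = 0\<close> to
    \<open>y1\<close> at \<open>t = 1\<close>.\<close>
  define G where "G t = vec_index (bhat n K lam (y2 + t \<cdot>\<^sub>v h))" for t
  have G: "is_min (\<lambda>k. vec_index y2 k + t * vec_index h k) (G t)" for t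
    by (rule is_min_cong[OF _ bhat_is_min(2)[of "y2 + t \<cdot>\<^sub>v h", folded G_def]])
      (use y2 h in auto)
  have ends: "G 0 = vec_index (bhat n K lam y2)" "G 1 = vec_index (bhat n K lam y1)"
  proof -
    have "y2 + 0 \<cdot>\<^sub>v h = y2" "y2 + 1 \<cdot>\<^sub>v h = y1"
      using y1 y2 by (auto simp: h_def intro!: eq_vecI)
    then show "G 0 = vec_index (bhat n K lam y2)" "G 1 = vec_index (bhat n K lam y1)"
      by (simp_all only: G_def)
  qed
  have hk: "\<bar>vec_index h k\<bar> \<le> max_norm h" if "k \<le> K" for k
    unfolding max_norm_def using h that by (intro Max_ge) auto
  have "\<bar>G 1 k - G 0 k\<bar> \<le> 216 * max_norm h" if "k \<le> K" for k
    using min_lipschitz[OF G lam' hk that] .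
  then show ?thesis
    unfolding max_norm_def[of "bhat n K lam y1 - bhat n K lam y2"] ends h_def[symmetric]
    using bhat_is_min(1)[OF y1] bhat_is_min(1)[OF y2] by (subst Max_le_iff) auto
qed

end

theorem theorem4p1:
  shows "\<exists>(lambda_bar :: real) (P :: nat) (kappa :: real).
    lambda_bar > 0 \<and> P > 0 \<and> kappa > 0 \<and>
    (\<forall>(n :: nat) (K :: nat) (lam :: real).
       n > 0 \<longrightarrow> K \<ge> 2 \<longrightarrow> K dvd n \<longrightarrow> real n / real K \<ge> real P \<longrightarrow>
       0 \<le> lam \<longrightarrow> lam \<le> lambda_bar \<longrightarrow>
       (\<forall>y1 \<in> carrier_vec (K + 1). \<forall>y2 \<in> carrier_vec (K + 1).
          max_norm (bhat n K lam y1 - bhat n K lam y2) \<le> kappa * max_norm (y1 - y2)))"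
\<comment> \<open>The witnesses are the penalty threshold of \<open>form_hat_lower\<close>, the
  number of design points per knot interval demanded by \<open>ramp_down_sum\<close>, and the
  constant of \<open>knot_bound\<close>.\<close>
proof (rule exI[of _ "1 / 3456"], rule exI[of _ 3], rule exI[of _ 216],
    intro conjI allI impI ballI)
  fix n K :: nat and lam :: real and y1 y2 :: "real Matrix.vec"
  assume a: "n > 0" "K \<ge> 2" "K dvd n" "real n / real K \<ge> real 3" "0 \<le> lam" "lam \<le> 1 / 3456"
    and y: "y1 \<in> carrier_vec (K + 1)" "y2 \<in> carrier_vec (K + 1)"
  from a(3) obtain M where M: "n = K * M" by blast
  with a(2,4) have "3 \<le> real M" by simp
  then have "3 \<le> M" by linarith
  interpret spline_qp n K M lam
    by unfold_locales (use M \<open>3 \<le> M\<close> a in auto)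
  show "max_norm (bhat n K lam y1 - bhat n K lam y2) \<le> 216 * max_norm (y1 - y2)"
    using y a(6) by (rule bhat_lipschitz)
qed auto

end
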